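(* Let $d\geq 1$ and $N\geq 2$ be integers, and for $i=1,\dots,N$ let $\mu_i=\frac12\left(\delta_{x_i^1}+\delta_{x_i^2}\right)$ be a probability measure on $\mathbb{R}^d$, where $x_i^1,x_i^2\in\mathbb{R}^d$ are distinct points. Then the problem of minimizing $$\int_{(\mathbb{R}^d)^N}\sum_{i,j=1}^N|x_i-x_j|^2\,d\gamma(x_1,\dots,x_N)$$ over $\gamma\in\Pi(\mu_1,\dots,\mu_N)$ has a Monge solution.
   Context: $\Pi(\mu_1,\dots,\mu_N)$ is the set of Borel probability measures on $(\mathbb{R}^d)^N$ whose marginals are $\mu_1,\dots,\mu_N$. A Monge solution is a minimizer $\gamma\in\Pi(\mu_1,\dots,\mu_N)$ which is concentrated on the graph of a function over the first variable, i.e. on $\{(x_1,T_2(x_1),\dots,T_N(x_1))\}$ for some maps $T_2,\dots,T_N$ defined on the support of $\mu_1$. *)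

theory Defs
  imports "HOL-Probability.Probability"
begin

definition half_dirac_sum :: "'a::topological_space \<Rightarrow> 'a \<Rightarrow> 'a measure" where
  "half_dirac_sum p q =
     measure_of UNIV (sets borel)
       (\<lambda>A. (emeasure (return borel p) A + emeasure (return borel q) A) / 2)"

text \<open>
  The constructor \<^const>\<open>measure_of\<close> yields the zero measure when its argument is not countably
  additive; the following lemma excludes this.
\<close>

lemma emeasure_half_dirac_sum:
  assumes "A \<in> sets borel"
  shows "emeasure (half_dirac_sum p q) A = (indicator A p + indicator A q) / 2"
proof -
  let ?h = "\<lambda>A. (emeasure (return borel p) A + emeasure (return borel q) A) / 2"
  have "countably_additive (sets borel) ?h"
  proof (rule countably_additiveI)
    fix B :: "nat \<Rightarrow> 'a set"
    assume B: "range B \<subseteq> sets borel" "disjoint_family B"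
    have "(\<Sum>i. ?h (B i))
        = ((\<Sum>i. emeasure (return borel p) (B i)) + (\<Sum>i. emeasure (return borel q) (B i))) / 2"
      by (simp add: divide_ennreal_def suminf_add[symmetric])
    also have "\<dots> = ?h (\<Union>i. B i)"
      using B by (simp only: suminf_emeasure sets_return)
    finally show "(\<Sum>i. ?h (B i)) = ?h (\<Union>i. B i)" .
  qed
  moreover have "positive (sets borel) ?h"
    by (simp add: positive_def)
  moreover have "sigma_algebra UNIV (sets (borel :: 'a measure))"
    using sets.sigma_algebra_axioms[of "borel :: 'a measure"] by simp
  ultimately have "emeasure (half_dirac_sum p q) A = ?h A"
    unfolding half_dirac_sum_def using assms by (intro emeasure_measure_of_sigma)
  then show ?thesis
    using assms by simp
qed

text \<open>
  Points of $(\mathbb{R}^d)^N$ are functions on the index set \<open>{1..N}\<close> (extended by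
  \<^const>\<open>undefined\<close>). Since $\mathbb{R}^d$ is second countable, the product
  sigma-algebra below is the Borel sigma-algebra of $(\mathbb{R}^d)^N$.
\<close>

definition couplings ::
    "nat \<Rightarrow> (nat \<Rightarrow> (real^'d) measure) \<Rightarrow> (nat \<Rightarrow> real^'d) measure set" where
  "couplings N \<mu> = {\<gamma>. prob_space \<gamma> \<and> sets \<gamma> = sets (PiM {1..N} (\<lambda>_. borel)) \<and>
     (\<forall>i\<in>{1..N}. distr \<gamma> borel (\<lambda>x. x i) = \<mu> i)}"

text \<open>The integrand is nonnegative, so the integral is taken with values in $[0,\infty]$.\<close>

definition transport_cost :: "nat \<Rightarrow> (nat \<Rightarrow> real^'d) measure \<Rightarrow> ennreal" where
  "transport_cost N \<gamma> =
     (\<integral>\<^sup>+ x. ennreal (\<Sum>i\<in>{1..N}. \<Sum>j\<in>{1..N}. (norm (x i - x j))\<^sup>2) \<partial>\<gamma>)"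

definition minimizer ::
    "nat \<Rightarrow> (nat \<Rightarrow> (real^'d) measure) \<Rightarrow> (nat \<Rightarrow> real^'d) measure \<Rightarrow> bool" where
  "minimizer N \<mu> \<gamma> \<longleftrightarrow> \<gamma> \<in> couplings N \<mu> \<and>
     (\<forall>\<gamma>'\<in>couplings N \<mu>. transport_cost N \<gamma> \<le> transport_cost N \<gamma>')"

definition measure_support :: "'a::topological_space measure \<Rightarrow> 'a set" where
  "measure_support \<mu> = {x. \<forall>U. open U \<and> x \<in> U \<longrightarrow> emeasure \<mu> U > 0}"

text \<open>
  The maps \<open>T i\<close> are total functions, but only their values on the support of
  \<open>\<mu> 1\<close> enter the definition.
\<close>

definition monge_solution ::
    "nat \<Rightarrow> (nat \<Rightarrow> (real^'d) measure) \<Rightarrow> (nat \<Rightarrow> real^'d) measure \<Rightarrow> bool" where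
  "monge_solution N \<mu> \<gamma> \<longleftrightarrow> minimizer N \<mu> \<gamma> \<and>
     (\<exists>T :: nat \<Rightarrow> real^'d \<Rightarrow> real^'d.
        AE x in \<gamma>. x 1 \<in> measure_support (\<mu> 1) \<and> (\<forall>i\<in>{2..N}. x i = T i (x 1)))"

end

theory Submission
  imports Defs
begin

text \<open>
  Every coupling lives on the finite set \<open>Z\<close> of points \<open>x\<close> with \<open>x i \<in> {x1 i, x2 i}\<close>.
  The reflection \<open>\<sigma>\<close> that exchanges \<open>x1 i\<close> and \<open>x2 i\<close> in all coordinates at once, that is
  \<open>x i \<mapsto> x1 i + x2 i - x i\<close>, maps \<open>Z\<close> to itself. Split the cost \<open>c\<close> into its even part
  \<open>(c + c \<circ> \<sigma>) / 2\<close> and its odd part \<open>(c - c \<circ> \<sigma>) / 2\<close>. Because \<open>c\<close> is quadratic, the odd part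
  is affine in \<open>x\<close>, hence a sum of functions of one coordinate each; its integral is therefore
  determined by the marginals, and it vanishes since the centres \<open>(x1 i + x2 i) / 2\<close> are the
  means of the marginals (\<open>integral_odd_part_coupling\<close>). So all couplings only compete in the
  even part, whose integral is at least its minimum over \<open>Z\<close>
  (\<open>transport_cost_ge_even_part\<close>). If the minimum is attained at \<open>z\<close>, the measure giving mass
  \<open>1/2\<close> to each of \<open>z\<close> and \<open>\<sigma> z\<close> attains this bound. It has the right marginals, and it sits on
  a graph over the first coordinate because \<open>z\<close> and \<open>\<sigma> z\<close> differ there.
\<close>

section \<open>Measures with two atoms of equal mass\<close>

text \<open>
  Realising the two-point measures as laws of a fair coin turns statements about their
  integrals, null sets and images into finite computations.
\<close>

definition coin_law :: "'a measure \<Rightarrow> 'a \<Rightarrow> 'a \<Rightarrow> 'a measure" where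
  "coin_law M p q = distr (measure_pmf (bernoulli_pmf (1/2))) M (\<lambda>b. if b then p else q)"

lemma sets_coin_law [simp]: "sets (coin_law M p q) = sets M"
  by (simp add: coin_law_def)

lemma coin_measurable:
  assumes "p \<in> space M" "q \<in> space M"
  shows "(\<lambda>b. if b then p else q) \<in> measure_pmf (bernoulli_pmf (1/2)) \<rightarrow>\<^sub>M M"
  using assms by (auto simp: measurable_def)

lemma prob_space_coin_law:
  assumes "p \<in> space M" "q \<in> space M"
  shows "prob_space (coin_law M p q)"
  unfolding coin_law_def
  by (intro prob_space.prob_space_distr prob_space_measure_pmf coin_measurable assms)

lemma distr_coin_law:
  assumes "p \<in> space M" "q \<in> space M" "f \<in> M \<rightarrow>\<^sub>M K"
  shows "distr (coin_law M p q) K f = coin_law K (f p) (f q)"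
  unfolding coin_law_def
  by (subst distr_distr[OF assms(3) coin_measurable[OF assms(1,2)]])
     (auto simp: comp_def if_distrib intro!: distr_cong)

lemma nn_integral_coin_law:
  fixes f :: "'a \<Rightarrow> real"
  assumes "p \<in> space M" "q \<in> space M" "f \<in> borel_measurable M" "f p \<ge> 0" "f q \<ge> 0"
  shows "(\<integral>\<^sup>+ x. ennreal (f x) \<partial>coin_law M p q) = ennreal ((f p + f q) / 2)"
proof -
  have "(\<integral>\<^sup>+ x. ennreal (f x) \<partial>coin_law M p q) =
      (\<integral>\<^sup>+ b. ennreal (f (if b then p else q)) \<partial>measure_pmf (bernoulli_pmf (1/2)))"
    unfolding coin_law_def using assms by (subst nn_integral_distr) (auto intro!: coin_measurable)
  also have "\<dots> = ennreal ((f p + f q) / 2)"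
    using assms
    by (simp add: nn_integral_bernoulli_pmf divide_ennreal_def distrib_right
        flip: divide_ennreal)
  finally show ?thesis .
qed

lemma half_dirac_sum_eq_coin_law: "half_dirac_sum p q = coin_law borel p q"
proof (rule measure_eqI)
  show sets_eq: "sets (half_dirac_sum p q) = sets (coin_law borel p q)"
    using sets.sigma_sets_eq[of "borel :: 'a measure"]
    by (simp add: half_dirac_sum_def)
  fix A :: "'a set" assume "A \<in> sets (half_dirac_sum p q)"
  then have A: "A \<in> sets borel"
    using sets_eq by simp
  have "emeasure (coin_law borel p q) A = (\<integral>\<^sup>+ x. ennreal (indicator A x) \<partial>coin_law borel p q)"
    using A by (simp add: ennreal_indicator)
  also have "\<dots> = ennreal ((indicator A p + indicator A q) / 2)"
    using A by (subst nn_integral_coin_law) auto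
  also have "\<dots> = (indicator A p + indicator A q) / 2"
    by (simp add: divide_ennreal[symmetric] ennreal_plus ennreal_indicator indicator_def)
  finally show "emeasure (half_dirac_sum p q) A = emeasure (coin_law borel p q) A"
    using A by (simp add: emeasure_half_dirac_sum)
qed

lemma half_dirac_sum_commute: "half_dirac_sum p q = half_dirac_sum q p"
  by (simp add: half_dirac_sum_def add.commute)

lemma AE_half_dirac_sum:
  fixes p q :: "'a::t1_space"
  shows "AE y in half_dirac_sum p q. y \<in> {p, q}"
  unfolding half_dirac_sum_eq_coin_law coin_law_def
  by (subst AE_distr_iff) (auto intro!: coin_measurable borel_closed finite_imp_closed)

lemma
  fixes f :: "'a::topological_space \<Rightarrow> real"
  assumes "f \<in> borel_measurable borel"
  shows integrable_half_dirac_sum: "integrable (half_dirac_sum p q) f"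
    and integral_half_dirac_sum: "(\<integral>y. f y \<partial>half_dirac_sum p q) = (f p + f q) / 2"
  unfolding half_dirac_sum_eq_coin_law coin_law_def using assms
  by (auto simp: integrable_distr_eq integral_distr coin_measurable integrable_measure_pmf_finite
      field_simps)

lemma atoms_in_support: "{p, q} \<subseteq> measure_support (half_dirac_sum p q)"
proof -
  have "emeasure (half_dirac_sum p q) U > 0" if "open U" "p \<in> U \<or> q \<in> U" for U
  proof -
    have "(indicator U p + indicator U q :: ennreal) \<noteq> 0"
      using that by (auto simp: indicator_def)
    then show ?thesis
      using \<open>open U\<close> by (simp add: emeasure_half_dirac_sum zero_less_iff_neq_zero ennreal_divide_eq_0_iff)
  qed
  then show ?thesis
    by (auto simp: measure_support_def)
qed

section \<open>The reflection and the odd part of the cost\<close>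

definition pair_cost :: "nat \<Rightarrow> (nat \<Rightarrow> 'a::real_inner) \<Rightarrow> real" where
  "pair_cost N x = (\<Sum>i\<in>{1..N}. \<Sum>j\<in>{1..N}. (norm (x i - x j))\<^sup>2)"

text \<open>
  With \<open>s i\<close> the sum of the two atoms of the \<open>i\<close>-th marginal, this exchanges the atoms of every
  marginal. The restriction keeps the result in the product space over \<open>{1..N}\<close>.
\<close>

definition reflect :: "nat \<Rightarrow> (nat \<Rightarrow> 'a::ab_group_add) \<Rightarrow> (nat \<Rightarrow> 'a) \<Rightarrow> nat \<Rightarrow> 'a" where
  "reflect N s x = (\<lambda>i\<in>{1..N}. s i - x i)"

definition even_cost :: "nat \<Rightarrow> (nat \<Rightarrow> 'a::real_inner) \<Rightarrow> (nat \<Rightarrow> 'a) \<Rightarrow> real" where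
  "even_cost N s x = (pair_cost N x + pair_cost N (reflect N s x)) / 2"

definition odd_cost :: "nat \<Rightarrow> (nat \<Rightarrow> 'a::real_inner) \<Rightarrow> (nat \<Rightarrow> 'a) \<Rightarrow> real" where
  "odd_cost N s x = (pair_cost N x - pair_cost N (reflect N s x)) / 2"

lemma pair_cost_nonneg: "pair_cost N x \<ge> 0"
  unfolding pair_cost_def by (intro sum_nonneg) auto

lemma transport_cost_eq: "transport_cost N \<gamma> = (\<integral>\<^sup>+ x. ennreal (pair_cost N x) \<partial>\<gamma>)"
  by (simp add: transport_cost_def pair_cost_def)

lemma pair_cost_measurable [measurable]:
  "(pair_cost N :: (nat \<Rightarrow> real^'d) \<Rightarrow> real) \<in> borel_measurable (PiM {1..N} (\<lambda>_. borel))"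
  unfolding pair_cost_def by measurable

text \<open>The squares of \<open>x i\<close> and \<open>x j\<close> cancel, so that only an affine function of \<open>x\<close> is left.\<close>

lemma odd_cost_affine:
  "odd_cost N s x =
     (\<Sum>i\<in>{1..N}. \<Sum>j\<in>{1..N}.
        (s i - s j) \<bullet> x i - (s i - s j) \<bullet> x j - (s i - s j) \<bullet> (s i - s j) / 2)"
proof -
  have *: "((norm (x i - x j))\<^sup>2 - (norm (reflect N s x i - reflect N s x j))\<^sup>2) / 2 =
      (s i - s j) \<bullet> x i - (s i - s j) \<bullet> x j - (s i - s j) \<bullet> (s i - s j) / 2"
    if "i \<in> {1..N}" "j \<in> {1..N}" for i j
  proof -
    have eq: "reflect N s x i - reflect N s x j = (s i - s j) - (x i - x j)"
      using that by (simp add: reflect_def)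
    have "((norm a)\<^sup>2 - (norm (b - a))\<^sup>2) / 2 = b \<bullet> a - b \<bullet> b / 2" for a b :: 'a
      by (simp add: power2_norm_eq_inner inner_diff_left inner_diff_right inner_commute)
    then show ?thesis
      unfolding eq by (simp only: inner_diff_right[of _ "x i" "x j"])
  qed
  have "odd_cost N s x = (\<Sum>i\<in>{1..N}. \<Sum>j\<in>{1..N}.
      ((norm (x i - x j))\<^sup>2 - (norm (reflect N s x i - reflect N s x j))\<^sup>2) / 2)"
    unfolding odd_cost_def pair_cost_def
    by (simp only: sum_subtractf[symmetric] sum_divide_distrib)
  also have "\<dots> = (\<Sum>i\<in>{1..N}. \<Sum>j\<in>{1..N}.
        (s i - s j) \<bullet> x i - (s i - s j) \<bullet> x j - (s i - s j) \<bullet> (s i - s j) / 2)"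
    by (intro sum.cong refl *)
  finally show ?thesis .
qed

section \<open>The lower bound for couplings\<close>

context
  fixes N :: nat and x1 x2 :: "nat \<Rightarrow> real^'d" and \<gamma> :: "(nat \<Rightarrow> real^'d) measure"
  assumes coupling: "\<gamma> \<in> couplings N (\<lambda>i. half_dirac_sum (x1 i) (x2 i))"
begin

lemma prob_space_coupling: "prob_space \<gamma>"
  using coupling by (simp add: couplings_def)

lemma sets_coupling [measurable_cong]: "sets \<gamma> = sets (PiM {1..N} (\<lambda>_. borel))"
  using coupling by (simp add: couplings_def)

lemma coordinate_measurable_coupling: "i \<in> {1..N} \<Longrightarrow> (\<lambda>x. x i) \<in> \<gamma> \<rightarrow>\<^sub>M borel"
  by measurable

lemma distr_coupling: "i \<in> {1..N} \<Longrightarrow> distr \<gamma> borel (\<lambda>x. x i) = half_dirac_sum (x1 i) (x2 i)"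
  using coupling by (simp add: couplings_def)

lemma AE_coupling: "AE x in \<gamma>. x \<in> (\<Pi>\<^sub>E i\<in>{1..N}. {x1 i, x2 i})"
proof -
  have "AE x in \<gamma>. x i \<in> {x1 i, x2 i}" if i: "i \<in> {1..N}" for i
    using AE_half_dirac_sum[of "x1 i" "x2 i"] unfolding distr_coupling[OF i, symmetric]
    by (subst (asm) AE_distr_iff[OF coordinate_measurable_coupling[OF i]]) auto
  then have "AE x in \<gamma>. \<forall>i\<in>{1..N}. x i \<in> {x1 i, x2 i}"
    by (intro AE_finite_allI) auto
  moreover have "AE x in \<gamma>. x \<in> extensional {1..N}"
    using sets_eq_imp_space_eq[OF sets_coupling] by (intro AE_I2) (auto simp: space_PiM PiE_def)
  ultimately show ?thesis
    by eventually_elim (auto simp: PiE_def)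
qed

lemma
  assumes i: "i \<in> {1..N}"
  shows integrable_inner_coupling: "integrable \<gamma> (\<lambda>x. a \<bullet> x i)"
    and integral_inner_coupling: "(\<integral>x. a \<bullet> x i \<partial>\<gamma>) = a \<bullet> (x1 i + x2 i) / 2"
proof -
  note X = coordinate_measurable_coupling[OF i]
  have f: "(\<lambda>y. a \<bullet> y) \<in> borel_measurable borel"
    by measurable
  show "integrable \<gamma> (\<lambda>x. a \<bullet> x i)"
    using integrable_half_dirac_sum[OF f, of "x1 i" "x2 i"]
    unfolding distr_coupling[OF i, symmetric] by (simp add: integrable_distr_eq[OF X f])
  show "(\<integral>x. a \<bullet> x i \<partial>\<gamma>) = a \<bullet> (x1 i + x2 i) / 2"
    using integral_half_dirac_sum[OF f, of "x1 i" "x2 i"]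
    unfolding distr_coupling[OF i, symmetric]
    by (simp add: integral_distr[OF X f] inner_add_right)
qed

lemma
  shows integrable_odd_part_coupling: "integrable \<gamma> (odd_cost N (\<lambda>i. x1 i + x2 i))"
    and integral_odd_part_coupling: "(\<integral>x. odd_cost N (\<lambda>i. x1 i + x2 i) x \<partial>\<gamma>) = 0"
proof -
  interpret prob_space \<gamma> by (rule prob_space_coupling)
  define s where "s = (\<lambda>i. x1 i + x2 i)"
  let ?t = "\<lambda>i j x. (s i - s j) \<bullet> x i - (s i - s j) \<bullet> x j - (s i - s j) \<bullet> (s i - s j) / 2"
  have int: "integrable \<gamma> (?t i j)" if "i \<in> {1..N}" "j \<in> {1..N}" for i j
    using that by (intro Bochner_Integration.integrable_diff integrable_inner_coupling) auto
  have zero: "(\<integral>x. ?t i j x \<partial>\<gamma>) = 0" if "i \<in> {1..N}" "j \<in> {1..N}" for i j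
  proof -
    have "(\<integral>x. ?t i j x \<partial>\<gamma>) =
        (s i - s j) \<bullet> s i / 2 - (s i - s j) \<bullet> s j / 2 - (s i - s j) \<bullet> (s i - s j) / 2"
      using that
      by (simp add: integrable_inner_coupling integral_inner_coupling prob_space s_def)
    also have "\<dots> = 0"
      by (simp add: inner_diff_right field_simps)
    finally show ?thesis .
  qed
  have odd: "odd_cost N s = (\<lambda>x. \<Sum>i\<in>{1..N}. \<Sum>j\<in>{1..N}. ?t i j x)"
    by (rule ext) (rule odd_cost_affine)
  have "integrable \<gamma> (odd_cost N s)"
    unfolding odd by (intro Bochner_Integration.integrable_sum int)
  moreover have "(\<integral>x. odd_cost N s x \<partial>\<gamma>) = (\<Sum>i\<in>{1..N}. \<Sum>j\<in>{1..N}. \<integral>x. ?t i j x \<partial>\<gamma>)"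
    unfolding odd
    by (subst Bochner_Integration.integral_sum, intro Bochner_Integration.integrable_sum int,
        assumption, assumption, intro sum.cong refl Bochner_Integration.integral_sum int)
  ultimately show "integrable \<gamma> (odd_cost N (\<lambda>i. x1 i + x2 i))"
      "(\<integral>x. odd_cost N (\<lambda>i. x1 i + x2 i) x \<partial>\<gamma>) = 0"
    by (simp_all add: zero flip: s_def)
qed

text \<open>The cost dominates \<open>e\<close> plus its odd part almost surely, and the odd part integrates to zero.\<close>

lemma transport_cost_ge_even_part:
  assumes e: "\<And>x. x \<in> (\<Pi>\<^sub>E i\<in>{1..N}. {x1 i, x2 i}) \<Longrightarrow> e \<le> even_cost N (\<lambda>i. x1 i + x2 i) x"
  shows "ennreal e \<le> transport_cost N \<gamma>"
proof -
  interpret prob_space \<gamma> by (rule prob_space_coupling)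
  define g where "g x = e + odd_cost N (\<lambda>i. x1 i + x2 i) x" for x
  have g: "integrable \<gamma> g"
    unfolding g_def by (intro Bochner_Integration.integrable_add integrable_odd_part_coupling) auto
  have "e = (\<integral>x. g x \<partial>\<gamma>)"
    unfolding g_def using integrable_odd_part_coupling
    by (simp add: integral_odd_part_coupling prob_space)
  also have "\<dots> \<le> (\<integral>x. max 0 (g x) \<partial>\<gamma>)"
    using g by (intro integral_mono integrable_max) auto
  finally have "ennreal e \<le> ennreal (\<integral>x. max 0 (g x) \<partial>\<gamma>)"
    by (rule ennreal_leI)
  also have "\<dots> = (\<integral>\<^sup>+ x. ennreal (max 0 (g x)) \<partial>\<gamma>)"
    using g by (intro nn_integral_eq_integral[symmetric] integrable_max) auto
  also have "\<dots> \<le> (\<integral>\<^sup>+ x. ennreal (pair_cost N x) \<partial>\<gamma>)"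
  proof (rule nn_integral_mono_AE)
    show "AE x in \<gamma>. ennreal (max 0 (g x)) \<le> ennreal (pair_cost N x)"
      using AE_coupling
    proof eventually_elim
      case (elim x)
      have "g x \<le> even_cost N (\<lambda>i. x1 i + x2 i) x + odd_cost N (\<lambda>i. x1 i + x2 i) x"
        using e[OF elim] by (simp add: g_def)
      also have "\<dots> = pair_cost N x"
        by (simp add: even_cost_def odd_cost_def field_simps)
      finally show ?case
        using pair_cost_nonneg[of N x] by (intro ennreal_leI) simp
    qed
  qed
  finally show ?thesis
    by (simp add: transport_cost_eq)
qed

end

section \<open>The antipodal coupling\<close>

text \<open>
  In each coordinate \<open>z\<close> and \<open>w\<close> are the two atoms in some order, and the order does not affect
  the marginal. The cost is the mean of the costs at \<open>z\<close> and at its reflection \<open>w\<close>, which is the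
  even part at \<open>z\<close>.
\<close>

lemma antipodal_coupling:
  fixes x1 x2 :: "nat \<Rightarrow> real^'d"
  assumes z: "z \<in> (\<Pi>\<^sub>E i\<in>{1..N}. {x1 i, x2 i})"
  defines "w \<equiv> reflect N (\<lambda>i. x1 i + x2 i) z"
  defines "\<gamma> \<equiv> coin_law (PiM {1..N} (\<lambda>_. borel)) z w"
  shows "\<gamma> \<in> couplings N (\<lambda>i. half_dirac_sum (x1 i) (x2 i))"
    and "transport_cost N \<gamma> = ennreal (even_cost N (\<lambda>i. x1 i + x2 i) z)"
    and "AE x in \<gamma>. x = z \<or> x = w"
proof -
  let ?P = "PiM {1..N} (\<lambda>_. borel :: (real^'d) measure)"
  have zw: "z \<in> space ?P" "w \<in> space ?P"
    using z by (auto simp: space_PiM w_def reflect_def PiE_def)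
  have "distr \<gamma> borel (\<lambda>x. x i) = half_dirac_sum (x1 i) (x2 i)" if i: "i \<in> {1..N}" for i
  proof -
    have "distr \<gamma> borel (\<lambda>x. x i) = half_dirac_sum (z i) (w i)"
      unfolding \<gamma>_def half_dirac_sum_eq_coin_law using i zw by (intro distr_coin_law) auto
    moreover have "z i = x1 i \<and> w i = x2 i \<or> z i = x2 i \<and> w i = x1 i"
      using z i by (auto simp: w_def reflect_def PiE_def Pi_def)
    ultimately show ?thesis
      using half_dirac_sum_commute by metis
  qed
  then show "\<gamma> \<in> couplings N (\<lambda>i. half_dirac_sum (x1 i) (x2 i))"
    using prob_space_coin_law[OF zw] by (simp add: couplings_def \<gamma>_def)
  show "transport_cost N \<gamma> = ennreal (even_cost N (\<lambda>i. x1 i + x2 i) z)"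
    unfolding transport_cost_eq \<gamma>_def even_cost_def w_def[symmetric]
    by (intro nn_integral_coin_law zw pair_cost_measurable pair_cost_nonneg)
  \<comment> \<open>A point of a finite product is a box with singleton sides, hence measurable.\<close>
  have "{y} \<in> sets ?P" if "y \<in> space ?P" for y
  proof -
    have "{y} = (\<Pi>\<^sub>E i\<in>{1..N}. {y i})"
      using that PiE_singleton[of y "{1..N}"] by (auto simp: space_PiM PiE_def)
    then show ?thesis
      by (simp add: sets_PiM_I_finite)
  qed
  from this[OF zw(1)] this[OF zw(2)] have "{z} \<union> {w} \<in> sets ?P"
    by (rule sets.Un)
  moreover have "{x \<in> space ?P. x = z \<or> x = w} = {z} \<union> {w}"
    using zw by auto
  ultimately have "{x \<in> space ?P. x = z \<or> x = w} \<in> sets ?P"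
    by simp
  then show "AE x in \<gamma>. x = z \<or> x = w"
    unfolding \<gamma>_def coin_law_def by (subst AE_distr_iff[OF coin_measurable[OF zw]]) auto
qed

theorem theorem1:
  fixes N :: nat and x1 x2 :: "nat \<Rightarrow> real^'d"
  assumes "N \<ge> 2"
    and "\<And>i. i \<in> {1..N} \<Longrightarrow> x1 i \<noteq> x2 i"
  shows "\<exists>\<gamma>. monge_solution N (\<lambda>i. half_dirac_sum (x1 i) (x2 i)) \<gamma>"
proof -
  define Z where "Z = (\<Pi>\<^sub>E i\<in>{1..N}. {x1 i, x2 i})"
  define E where "E = even_cost N (\<lambda>i. x1 i + x2 i)"
  have "finite Z" "Z \<noteq> {}"
    by (auto simp: Z_def PiE_eq_empty_iff intro!: finite_PiE)
  then obtain z where z: "z \<in> Z" and min: "\<And>x. x \<in> Z \<Longrightarrow> E z \<le> E x"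
    using ex_min_if_finite[of "E ` Z"] by (metis arg_min_if_finite(1) arg_min_least)
  define w where "w = reflect N (\<lambda>i. x1 i + x2 i) z"
  define \<gamma> where "\<gamma> = coin_law (PiM {1..N} (\<lambda>_. borel)) z w"
  note anti = antipodal_coupling[OF z[unfolded Z_def], folded w_def, folded \<gamma>_def E_def]
  have "minimizer N (\<lambda>i. half_dirac_sum (x1 i) (x2 i)) \<gamma>"
    unfolding minimizer_def anti(2)
    using anti(1) min by (auto simp only: E_def Z_def intro: transport_cost_ge_even_part)
  moreover have "\<exists>T :: nat \<Rightarrow> real^'d \<Rightarrow> real^'d. AE x in \<gamma>.
      x 1 \<in> measure_support (half_dirac_sum (x1 1) (x2 1)) \<and> (\<forall>i\<in>{2..N}. x i = T i (x 1))"
  proof -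
    have one: "1 \<in> {1..N}"
      using assms(1) by simp
    have atoms: "{z 1, w 1} = {x1 1, x2 1}"
      using z one by (auto simp: Z_def w_def reflect_def PiE_def Pi_def)
    then have "z 1 \<noteq> w 1"
      using assms(2)[OF one] by auto
    moreover have "{z 1, w 1} \<subseteq> measure_support (half_dirac_sum (x1 1) (x2 1))"
      unfolding atoms by (rule atoms_in_support)
    ultimately have "AE x in \<gamma>. x 1 \<in> measure_support (half_dirac_sum (x1 1) (x2 1)) \<and>
        (\<forall>i\<in>{2..N}. x i = (if x 1 = z 1 then z i else w i))"
      using anti(3) by (auto elim!: eventually_mono)
    then show ?thesis
      by (intro exI[of _ "\<lambda>i y. if y = z 1 then z i else w i"])
  qed
  ultimately show ?thesis
    unfolding monge_solution_def by blast
qed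

end
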